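(* Let $d\ge 1$, and let $T$, $K$, $X_1,\dots,X_d$ be as in the context. Define coefficients $\alpha_{\mathbf n}$, $\mathbf n\in\mathbb{N}_0^d$, with unspecified values $\alpha_{\mathbf e_1},\dots,\alpha_{\mathbf e_d}$ (regarded as indeterminates), as follows: $\alpha_{\boldsymbol 0}=0$; for $\mathbf n=n_\ell\mathbf e_\ell$ with $n_\ell\ge1$, $1\le \ell\le d$, $$\alpha_{\mathbf n}=\frac{\alpha_{\mathbf e_\ell}^{n_\ell}X_\ell^{n_\ell-1}(1-X_\ell^{n_\ell d})}{(1-X_\ell^d)(1-X_\ell)^{n_\ell-1}(1-X_\ell^{d+1})^{n_\ell-1}};$$ and for all other $\mathbf n$ (at least two nonzero coordinates) recursively by $$\alpha_{\mathbf n}\Big(-\frac{1}{zT^{2d}}+\sum_{\ell=-d}^{d}\mathbf X^{\ell\mathbf n}\Big)=\sum_{\ell=2}^{2d+1}(-1)^\ell\sum_{\mathbf g_1+\dots+\mathbf g_\ell=\mathbf n}\Big(\prod_{k=1}^{\ell}\alpha_{\mathbf g_k}\Big)\sum_{\{b_1<\dots<b_\ell\}\subseteq\{-d,\dots,d\}}\ \prod_{k=1}^{\ell}\mathbf X^{b_k\mathbf g_k},$$ where the middle sum is over ordered tuples of vectors $\mathbf g_k\in\mathbb{N}_0^d\setminus\{\boldsymbol 0\}$. For $j\in\mathbb{Z}$ put $$\rho_j=\sum_{\mathbf n\in\mathbb{N}_0^d}\alpha_{\mathbf n}\mathbf X^{j\mathbf n}.$$ Then the formal power series $T_j=T(1-\rho_j)$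 satisfies $$T_j=1+z\prod_{\ell=-d}^{d}T_{j+\ell},\qquad j\in\mathbb{Z}.$$ Equivalently, for all $j\in\mathbb{Z}$, $$\rho_j=zT^{2d}\sum_{\ell=1}^{2d+1}(-1)^{\ell-1}\sum_{\{b_1,\dots,b_\ell\}\subseteq\{-d,\dots,d\}}\ \prod_{k=1}^{\ell}\rho_{j+b_k},$$ the inner sum being over all subsets of size $\ell$.
   Context: $T=T(z)$ is the formal power series with $T(0)=1$ and $T=1+zT^{2d+1}$ (generating function of $(2d+1)$-ary trees). $K=\bigcup_{m\ge1}\mathbb{C}((z^{1/m}))$ is the field of Puiseux series in $z$. $X_1,\dots,X_d\in K$ are the $d$ small solutions (those of positive order in $z$, i.e. tending to $0$ as $z\to0$) of the characteristic equation $$1=zT^{2d}\sum_{\ell=-d}^{d}X^\ell .$$ Notation: $\mathbb{N}_0=\{0,1,2,\dots\}$; $\mathbf e_\ell$ is the $\ell$-th unit vector of $\mathbb{N}_0^d$; for $\mathbf n=(n_1,\dots,n_d)$ and $m\in\mathbb{Z}$, $\mathbf X^{m\mathbf n}=X_1^{mn_1}\cdots X_d^{mn_d}$. Each $\alpha_{\mathbf n}$ is an element of $K$ times the monomial $\prod_{\ell}\alpha_{\mathbf e_\ell}^{n_\ell}$, and $\rho_j,T_j$ are regarded as formal power series in the indeterminates $\alpha_{\mathbf e_1},\dots,\alpha_{\mathbf e_d}$ with coefficients in $K$. *)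

theory Defs
  imports
    "HOL-Analysis.Finite_Cartesian_Product"
    "HOL-Computational_Algebra.Formal_Laurent_Series"
    "HOL-Library.Groups_Big_Fun"
begin

section \<open>Puiseux series over the complex numbers\<close>

text \<open>
  The field of Puiseux series is the directed union of the fields of Laurent series in
  \<open>z\<^sup>1\<^sup>/\<^sup>m\<close>, \<open>m \<ge> 1\<close>. A pair \<open>(m, f)\<close> with \<open>m > 0\<close> stands for \<open>f(z\<^sup>1\<^sup>/\<^sup>m)\<close>; two pairs
  \<open>(m, f)\<close>, \<open>(k, g)\<close> are identified iff \<open>f(w\<^sup>k) = g(w\<^sup>m)\<close>, where \<open>w = z\<^sup>1\<^sup>/\<^sup>m\<^sup>k\<close>.
\<close>

lemma fls_compose_power_compose:
  assumes "m > 0" "k > 0"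
  shows "fls_compose_power (fls_compose_power f m) k = fls_compose_power f (m * k)"
proof (rule fls_eqI)
  fix n :: int
  have "(int k dvd n \<and> int m dvd n div int k) \<longleftrightarrow> int (m * k) dvd n"
  proof
    assume "int k dvd n \<and> int m dvd n div int k"
    then obtain b where "n div int k = int m * b" "int k dvd n" by (metis dvdE)
    then have "n = int (m * k) * b" by (metis dvd_mult_div_cancel mult.assoc mult.commute of_nat_mult)
    then show "int (m * k) dvd n" by simp
  next
    assume "int (m * k) dvd n"
    then obtain a where "n = int (m * k) * a" by (auto elim!: dvdE)
    then have "n = int k * (int m * a)" by (simp add: mult_ac)
    with assms show "int k dvd n \<and> int m dvd n div int k" by simp
  qed
  moreover have "n div int k div int m = n div int (m * k)"
    using zdiv_zmult2_eq[of "int m" n "int k"] assms by (simp add: mult.commute)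
  ultimately show "fls_nth (fls_compose_power (fls_compose_power f m) k) n = fls_nth (fls_compose_power f (m * k)) n"
    using assms by (auto simp: fls_nth_compose_power)
qed

lemma fls_compose_power_one_right: "fls_compose_power f (Suc 0) = f"
  by (rule fls_eqI) (simp add: fls_nth_compose_power)

lemma fls_compose_power_inject:
  assumes "k > 0"
  shows "fls_compose_power f k = fls_compose_power g k \<longleftrightarrow> f = g"
proof
  assume *: "fls_compose_power f k = fls_compose_power g k"
  show "f = g"
  proof (rule fls_eqI)
    fix n
    have "fls_nth (fls_compose_power f k) (int k * n) = fls_nth (fls_compose_power g k) (int k * n)"
      by (simp add: *)
    with assms show "fls_nth f n = fls_nth g n" by (simp add: fls_nth_compose_power)
  qed
qed simp

lemma fls_compose_power_eq_0_iff:
  assumes "k > 0"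
  shows "fls_compose_power f k = 0 \<longleftrightarrow> f = 0"
  using fls_compose_power_inject[OF assms, of f 0] by simp

lemma fls_compose_power_inverse:
  assumes "k > 0"
  shows "fls_compose_power (inverse f :: 'a :: field fls) k = inverse (fls_compose_power f k)"
proof (cases "f = 0")
  case False
  then have "fls_compose_power (inverse f) k * fls_compose_power f k = 1"
    using assms by (simp flip: fls_compose_power_mult)
  then show ?thesis
    by (metis inverse_unique mult.commute)
qed simp

lemma fls_subdegree_compose_power:
  assumes "k > 0"
  shows "fls_subdegree (fls_compose_power f k) = int k * fls_subdegree f"
proof (cases "f = 0")
  case False
  show ?thesis
  proof (rule fls_subdegree_eqI)
    show "fls_nth (fls_compose_power f k) (int k * fls_subdegree f) \<noteq> 0"
      using assms False by (simp add: fls_nth_compose_power nth_fls_subdegree_nonzero)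
  next
    fix n assume *: "n < int k * fls_subdegree f"
    show "fls_nth (fls_compose_power f k) n = 0"
    proof (cases "int k dvd n")
      case True
      then obtain a where a: "n = int k * a" by (auto elim!: dvdE)
      with * assms have "a < fls_subdegree f" by simp
      with a assms show ?thesis by (simp add: fls_nth_compose_power)
    qed (use assms in \<open>simp add: fls_nth_compose_power\<close>)
  qed
qed simp

definition puiseux_rel :: "nat \<times> complex fls \<Rightarrow> nat \<times> complex fls \<Rightarrow> bool" where
  "puiseux_rel p q \<longleftrightarrow> fst p > 0 \<and> fst q > 0 \<and>
     fls_compose_power (snd p) (fst q) = fls_compose_power (snd q) (fst p)"

lemma puiseux_rel_transp: "transp puiseux_rel"
proof (rule transpI)
  fix x y w assume "puiseux_rel x y" "puiseux_rel y w"
  moreover obtain a f b g c h where [simp]: "x = (a, f)" "y = (b, g)" "w = (c, h)"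
    by (metis surj_pair)
  ultimately have pos: "a > 0" "b > 0" "c > 0"
    and 1: "fls_compose_power f b = fls_compose_power g a"
    and 2: "fls_compose_power g c = fls_compose_power h b"
    by (auto simp: puiseux_rel_def)
  have "fls_compose_power (fls_compose_power f c) b = fls_compose_power (fls_compose_power f b) c"
    using pos by (simp add: fls_compose_power_compose mult.commute)
  also have "\<dots> = fls_compose_power (fls_compose_power g c) a"
    using pos by (simp add: 1 fls_compose_power_compose mult.commute)
  also have "\<dots> = fls_compose_power (fls_compose_power h a) b"
    using pos by (simp add: 2 fls_compose_power_compose mult.commute)
  finally show "puiseux_rel x w"
    using pos by (simp add: puiseux_rel_def fls_compose_power_inject)
qed

quotient_type puiseux = "nat \<times> complex fls" / partial: puiseux_rel
proof (rule part_equivpI)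
  show "\<exists>x. puiseux_rel x x" by (rule exI[of _ "(1, 0)"]) (simp add: puiseux_rel_def)
  show "symp puiseux_rel" by (auto intro!: sympI simp: puiseux_rel_def)
  show "transp puiseux_rel" by (rule puiseux_rel_transp)
qed

instantiation puiseux :: field
begin

lift_definition zero_puiseux :: puiseux is "(1, 0)"
  by (simp add: puiseux_rel_def)

lift_definition one_puiseux :: puiseux is "(1, 1)"
  by (simp add: puiseux_rel_def)

lift_definition plus_puiseux :: "puiseux \<Rightarrow> puiseux \<Rightarrow> puiseux" is
  "\<lambda>(m, f) (k, g). (m * k, fls_compose_power f k + fls_compose_power g m)"
proof (clarsimp simp: puiseux_rel_def)
  fix a b c d :: nat and f g h i :: "complex fls"
  assume pos: "0 < a" "0 < b" "0 < c" "0 < d"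
    and 1: "fls_compose_power f b = fls_compose_power g a"
    and 2: "fls_compose_power h d = fls_compose_power i c"
  have "fls_compose_power f (c * (b * d)) = fls_compose_power g (d * (a * c))"
    using arg_cong[OF 1, of "\<lambda>F. fls_compose_power F (c * d)"] pos
    by (simp add: fls_compose_power_compose mult_ac)
  moreover have "fls_compose_power h (a * (b * d)) = fls_compose_power i (b * (a * c))"
    using arg_cong[OF 2, of "\<lambda>F. fls_compose_power F (a * b)"] pos
    by (simp add: fls_compose_power_compose mult_ac)
  ultimately show "fls_compose_power (fls_compose_power f c) (b * d) +
      fls_compose_power (fls_compose_power h a) (b * d) =
      fls_compose_power (fls_compose_power g d) (a * c) +
      fls_compose_power (fls_compose_power i b) (a * c)"
    using pos by (simp add: fls_compose_power_compose)
qed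

lift_definition times_puiseux :: "puiseux \<Rightarrow> puiseux \<Rightarrow> puiseux" is
  "\<lambda>(m, f) (k, g). (m * k, fls_compose_power f k * fls_compose_power g m)"
proof (clarsimp simp: puiseux_rel_def)
  fix a b c d :: nat and f g h i :: "complex fls"
  assume pos: "0 < a" "0 < b" "0 < c" "0 < d"
    and 1: "fls_compose_power f b = fls_compose_power g a"
    and 2: "fls_compose_power h d = fls_compose_power i c"
  have "fls_compose_power f (c * (b * d)) = fls_compose_power g (d * (a * c))"
    using arg_cong[OF 1, of "\<lambda>F. fls_compose_power F (c * d)"] pos
    by (simp add: fls_compose_power_compose mult_ac)
  moreover have "fls_compose_power h (a * (b * d)) = fls_compose_power i (b * (a * c))"
    using arg_cong[OF 2, of "\<lambda>F. fls_compose_power F (a * b)"] pos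
    by (simp add: fls_compose_power_compose mult_ac)
  ultimately show "fls_compose_power (fls_compose_power f c) (b * d) *
      fls_compose_power (fls_compose_power h a) (b * d) =
      fls_compose_power (fls_compose_power g d) (a * c) *
      fls_compose_power (fls_compose_power i b) (a * c)"
    using pos by (simp add: fls_compose_power_compose)
qed

lift_definition uminus_puiseux :: "puiseux \<Rightarrow> puiseux" is "\<lambda>(m, f). (m, - f)"
  by (auto simp: puiseux_rel_def)

lift_definition inverse_puiseux :: "puiseux \<Rightarrow> puiseux" is "\<lambda>(m, f). (m, inverse f)"
  by (auto simp: puiseux_rel_def fls_compose_power_inverse)

definition minus_puiseux :: "puiseux \<Rightarrow> puiseux \<Rightarrow> puiseux" where
  "minus_puiseux x y = x + (- y)"

definition divide_puiseux :: "puiseux \<Rightarrow> puiseux \<Rightarrow> puiseux" where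
  "divide_puiseux x y = x * inverse y"

instance
proof
  fix x y w :: puiseux
  show "x + y + w = x + (y + w)"
    by transfer
      (auto simp: puiseux_rel_def fls_compose_power_compose algebra_simps)
  show "x + y = y + x"
    by transfer (auto simp: puiseux_rel_def fls_compose_power_compose algebra_simps)
  show "0 + x = x"
    by transfer (auto simp: puiseux_rel_def fls_compose_power_one_right)
  show "- x + x = 0"
    by transfer (auto simp: puiseux_rel_def)
  show "x - y = x + - y"
    by (simp add: minus_puiseux_def)
  show "x * y * w = x * (y * w)"
    by transfer (auto simp: puiseux_rel_def fls_compose_power_compose algebra_simps)
  show "x * y = y * x"
    by transfer (auto simp: puiseux_rel_def fls_compose_power_compose algebra_simps)
  show "1 * x = x"
    by transfer (auto simp: puiseux_rel_def fls_compose_power_one_right)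
  show "(x + y) * w = x * w + y * w"
    by transfer (auto simp: puiseux_rel_def fls_compose_power_compose algebra_simps)
  show "(0 :: puiseux) \<noteq> 1"
    by transfer (auto simp: puiseux_rel_def)
  show "x \<noteq> 0 \<Longrightarrow> inverse x * x = 1"
    by transfer (auto simp: puiseux_rel_def fls_compose_power_inverse
        fls_compose_power_eq_0_iff fls_compose_power_one_right)
  show "x div y = x * inverse y"
    by (simp add: divide_puiseux_def)
  show "inverse (0 :: puiseux) = 0"
    by transfer (auto simp: puiseux_rel_def)
qed

end

lift_definition puiseux_of_fps :: "complex fps \<Rightarrow> puiseux" is "\<lambda>f. (1, fps_to_fls f)"
  by (simp add: puiseux_rel_def)

text \<open>Pitfall: as for \<^const>\<open>fls_subdegree\<close>, the order of the zero series is \<open>0\<close> by convention.\<close>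

lift_definition puiseux_order :: "puiseux \<Rightarrow> rat" is
  "\<lambda>(m, f). of_int (fls_subdegree f) / of_nat m"
proof (clarsimp simp: puiseux_rel_def)
  fix a b :: nat and f g :: "complex fls"
  assume pos: "0 < a" "0 < b" and "fls_compose_power f b = fls_compose_power g a"
  then have "int b * fls_subdegree f = int a * fls_subdegree g"
    by (metis fls_subdegree_compose_power)
  then have "(of_int (int b * fls_subdegree f) :: rat) = of_int (int a * fls_subdegree g)"
    by (rule arg_cong)
  with pos show "(of_int (fls_subdegree f) :: rat) / of_nat a = of_int (fls_subdegree g) / of_nat b"
    by (simp add: field_simps)
qed


section \<open>Formal power series in several indeterminates\<close>

text \<open>
  \<open>('a, 'v) mps\<close> is the ring of formal power series with coefficients in \<open>'a\<close> and one
  indeterminate for each element of the finite type \<open>'v\<close>; \<open>mps_coeff f n\<close> is the coefficient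
  of the monomial with exponent vector \<open>n\<close>.
\<close>

typedef ('a, 'v :: finite) mps = "UNIV :: (nat ^ 'v \<Rightarrow> 'a) set"
  morphisms mps_coeff Abs_mps ..

setup_lifting type_definition_mps

lemma finite_vec_le: "finite {p :: nat ^ 'v :: finite. p \<le> n}"
proof (rule finite_subset)
  show "{p. p \<le> n} \<subseteq> vec_lambda ` {f. \<forall>i. f i \<in> {..n $ i}}"
  proof
    fix p assume "p \<in> {p. p \<le> n}"
    then have "p = vec_lambda (vec_nth p)" "vec_nth p \<in> {f. \<forall>i. f i \<in> {..n $ i}}"
      by (auto simp: less_eq_vec_def)
    then show "p \<in> vec_lambda ` {f. \<forall>i. f i \<in> {..n $ i}}" by blast
  qed
  have "finite (PiE UNIV (\<lambda>i. {..n $ i}))" by (rule finite_PiE) auto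
  moreover have "{f. \<forall>i. f i \<in> {..n $ i}} = PiE UNIV (\<lambda>i. {..n $ i})"
    by (auto simp: PiE_def)
  ultimately show "finite (vec_lambda ` {f. \<forall>i. f i \<in> {..n $ i}})" by simp
qed

lemma finite_vec_splits: "finite {(p, q). p + q = (n :: nat ^ 'v :: finite)}"
  by (rule finite_subset[of _ "{p. p \<le> n} \<times> {p. p \<le> n}"])
    (auto simp: less_eq_vec_def intro!: finite_cartesian_product finite_vec_le[unfolded less_eq_vec_def])

lift_definition mps_const :: "'a :: zero \<Rightarrow> ('a, 'v :: finite) mps" is
  "\<lambda>c n. if n = 0 then c else 0" .

lift_definition mps_var :: "'v :: finite \<Rightarrow> ('a :: zero_neq_one, 'v) mps" is
  "\<lambda>v n. if n = axis v 1 then 1 else 0" .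

instantiation mps :: (comm_ring_1, finite) comm_ring_1
begin

lift_definition zero_mps :: "('a, 'b) mps" is "\<lambda>_. 0" .

lift_definition one_mps :: "('a, 'b) mps" is "\<lambda>n. if n = 0 then 1 else 0" .

lift_definition plus_mps :: "('a, 'b) mps \<Rightarrow> ('a, 'b) mps \<Rightarrow> ('a, 'b) mps" is
  "\<lambda>f g n. f n + g n" .

lift_definition minus_mps :: "('a, 'b) mps \<Rightarrow> ('a, 'b) mps \<Rightarrow> ('a, 'b) mps" is
  "\<lambda>f g n. f n - g n" .

lift_definition uminus_mps :: "('a, 'b) mps \<Rightarrow> ('a, 'b) mps" is
  "\<lambda>f n. - f n" .

lift_definition times_mps :: "('a, 'b) mps \<Rightarrow> ('a, 'b) mps \<Rightarrow> ('a, 'b) mps" is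
  "\<lambda>f g n. \<Sum>(p, q) | p + q = n. f p * g q" .

instance
proof
  fix f g h :: "('a, 'b) mps"
  show "f + g + h = f + (g + h)" "f + g = g + f" "0 + f = f" "- f + f = 0" "f - g = f + - g"
    by (transfer; simp add: fun_eq_iff add_ac)+
  show "f * g = g * f"
  proof (transfer, rule ext)
    fix f g :: "nat ^ 'b \<Rightarrow> 'a" and n
    show "(\<Sum>(p, q) | p + q = n. f p * g q) = (\<Sum>(p, q) | p + q = n. g p * f q)"
      by (rule sum.reindex_bij_witness[of _ prod.swap prod.swap]) (auto simp: add_ac mult_ac)
  qed
  show "(f + g) * h = f * h + g * h"
    by (transfer, rule ext)
      (simp add: ring_distribs case_prod_unfold sum.distrib)
  show "1 * f = f"
  proof (transfer, rule ext)
    fix f :: "nat ^ 'b \<Rightarrow> 'a" and n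
    have "(\<Sum>(p, q) | p + q = n. (if p = 0 then 1 else 0) * f q)
        = (\<Sum>(p, q) \<in> {(0 :: nat ^ 'b, n)}. (if p = 0 then 1 else 0) * f q)"
      by (intro sum.mono_neutral_right) (auto simp: finite_vec_splits split: if_splits)
    then show "(\<Sum>(p, q) | p + q = n. (if p = 0 then 1 else 0) * f q) = f n"
      by simp
  qed
  show "f * g * h = f * (g * h)"
  proof (transfer, rule ext)
    fix f g h :: "nat ^ 'b \<Rightarrow> 'a" and n
    let ?S = "\<lambda>n. {(p, q). p + q = (n :: nat ^ 'b)}"
    have "(\<Sum>(p, q) \<in> ?S n. (\<Sum>(u, v) \<in> ?S p. f u * g v) * h q)
        = (\<Sum>x \<in> ?S n. \<Sum>y \<in> ?S (fst x). f (fst y) * g (snd y) * h (snd x))"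
      by (simp add: case_prod_unfold sum_distrib_right)
    also have "\<dots> = (\<Sum>(x, y) \<in> (SIGMA x : ?S n. ?S (fst x)). f (fst y) * g (snd y) * h (snd x))"
      by (rule sum.Sigma) (auto simp: finite_vec_splits)
    also have "\<dots> = (\<Sum>(x, y) \<in> (SIGMA x : ?S n. ?S (snd x)). f (fst x) * (g (fst y) * h (snd y)))"
      by (rule sum.reindex_bij_witness[of _
            "\<lambda>((u, r), (v, q)). ((u + v, q), (u, v))"
            "\<lambda>((p, q), (u, v)). ((u, v + q), (v, q))"])
        (auto simp: add_ac mult_ac)
    also have "\<dots> = (\<Sum>x \<in> ?S n. \<Sum>y \<in> ?S (snd x). f (fst x) * (g (fst y) * h (snd y)))"
      by (rule sum.Sigma[symmetric]) (auto simp: finite_vec_splits)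
    also have "\<dots> = (\<Sum>(p, q) \<in> ?S n. f p * (\<Sum>(u, v) \<in> ?S q. g u * h v))"
      by (simp add: case_prod_unfold sum_distrib_left)
    finally show "(\<Sum>(p, q) \<in> ?S n. (\<Sum>(u, v) \<in> ?S p. f u * g v) * h q)
        = (\<Sum>(p, q) \<in> ?S n. f p * (\<Sum>(u, v) \<in> ?S q. g u * h v))" .
  qed
  show "(0 :: ('a, 'b) mps) \<noteq> 1"
    by transfer (auto simp: fun_eq_iff)
qed

end

text \<open>
  Formal sum of an infinite family, taken coefficientwise. It is meaningful for families in which
  every monomial occurs in only finitely many members, as for the families below.
\<close>

lift_definition mps_Sum_any :: "('i \<Rightarrow> ('a :: comm_monoid_add, 'v :: finite) mps) \<Rightarrow> ('a, 'v) mps" is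
  "\<lambda>f n. Sum_any (\<lambda>i. f i n)" .


section \<open>The characteristic equation and the series \<open>\<rho>\<^sub>j\<close>, \<open>T\<^sub>j\<close>\<close>

definition puiseux_z :: puiseux where
  "puiseux_z = puiseux_of_fps fps_X"

definition small_solutions :: "nat \<Rightarrow> complex fps \<Rightarrow> puiseux set" where
  "small_solutions d T = {x. 0 < puiseux_order x \<and>
     1 = puiseux_z * puiseux_of_fps T ^ (2 * d) * (\<Sum>l\<in>{-int d..int d}. x powi l)}"

text \<open>The monomial \<open>\<^bold>X\<^sup>m\<^sup>\<^bold>n = \<Prod>\<^sub>l X\<^sub>l\<^bsup>m n\<^sub>l\<^esup>\<close>:\<close>

definition X_pow :: "('d :: finite \<Rightarrow> puiseux) \<Rightarrow> int \<Rightarrow> nat ^ 'd \<Rightarrow> puiseux" where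
  "X_pow X m n = (\<Prod>l\<in>UNIV. X l powi (m * int (n $ l)))"

text \<open>Ordered \<open>l\<close>-tuples of nonzero vectors with sum \<open>n\<close>:\<close>

definition vec_compositions :: "nat \<Rightarrow> nat ^ 'd :: finite \<Rightarrow> (nat ^ 'd) list set" where
  "vec_compositions l n = {gs. length gs = l \<and> 0 \<notin> set gs \<and> sum_list gs = n}"

text \<open>
  The index set \<open>{1, \<dots>, d}\<close> is the type \<open>'d\<close>, so \<open>d\<close> below always is \<open>CARD('d)\<close>, the set
  \<open>\<nat>\<^sub>0\<^sup>d\<close> is \<open>nat ^ 'd\<close> and \<open>n\<^sub>l \<^bold>e\<^sub>l\<close> is \<open>axis l n\<^sub>l\<close>. The indeterminate \<open>\<alpha>\<^bsub>\<^bold>e\<^sub>l\<^esub>\<close> is \<open>mps_var l\<close>;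
  the clause for \<open>axis l k\<close> with \<open>k = 1\<close> says that it is indeed the value of \<open>\<alpha>\<close> at
  \<open>\<^bold>e\<^sub>l\<close>. In the last clause \<open>sorted_list_of_set B ! k\<close> is the element of \<open>B\<close> with
  exactly \<open>k\<close> smaller ones (counting from \<open>0\<close>).

  When \<open>X\<close> enumerates the small solutions, the three clauses determine \<open>\<alpha>\<close>: each \<open>X\<^sub>l\<close> has order
  \<open>1/d\<close>, so the denominators in the second clause do not vanish, and neither does the factor of
  \<open>\<alpha> n\<close> in the last one, because its vanishing would make \<open>\<^bold>X\<^sup>\<^bold>n\<close>, which has order at least
  \<open>2/d\<close>, a small solution; only values of \<open>\<alpha>\<close> at vectors with smaller sum of
  coordinates than \<open>n\<close> occur on the right-hand side.
\<close>

definition alpha_family ::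
  "complex fps \<Rightarrow> ('d :: finite \<Rightarrow> puiseux) \<Rightarrow> (nat ^ 'd \<Rightarrow> (puiseux, 'd) mps) \<Rightarrow> bool" where
  "alpha_family T X \<alpha> \<longleftrightarrow> (let d = CARD('d) in
     \<alpha> 0 = 0 \<and>
     (\<forall>l k. k \<ge> 1 \<longrightarrow>
        \<alpha> (axis l k) = mps_var l ^ k *
          mps_const (X l ^ (k - 1) * (1 - X l ^ (k * d)) /
            ((1 - X l ^ d) * (1 - X l) ^ (k - 1) * (1 - X l ^ (d + 1)) ^ (k - 1)))) \<and>
     (\<forall>n. card {i. n $ i \<noteq> 0} \<ge> 2 \<longrightarrow>
        \<alpha> n * mps_const (- (1 / (puiseux_z * puiseux_of_fps T ^ (2 * d)))
                         + (\<Sum>l\<in>{-int d..int d}. X_pow X l n)) =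
        (\<Sum>l=2..2 * d + 1. (- 1) ^ l *
           (\<Sum>gs\<in>vec_compositions l n. (\<Prod>k<l. \<alpha> (gs ! k)) *
              mps_const (\<Sum>B | B \<subseteq> {-int d..int d} \<and> card B = l.
                           \<Prod>k<l. X_pow X (sorted_list_of_set B ! k) (gs ! k))))))"

definition rho ::
  "('d :: finite \<Rightarrow> puiseux) \<Rightarrow> (nat ^ 'd \<Rightarrow> (puiseux, 'd) mps) \<Rightarrow> int \<Rightarrow> (puiseux, 'd) mps" where
  "rho X \<alpha> j = mps_Sum_any (\<lambda>n. \<alpha> n * mps_const (X_pow X j n))"

definition T_series ::
  "complex fps \<Rightarrow> ('d :: finite \<Rightarrow> puiseux) \<Rightarrow> (nat ^ 'd \<Rightarrow> (puiseux, 'd) mps) \<Rightarrow> int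
     \<Rightarrow> (puiseux, 'd) mps" where
  "T_series T X \<alpha> j = mps_const (puiseux_of_fps T) * (1 - rho X \<alpha> j)"

end

theory Submission
  imports Defs
begin

text \<open>
  Put \<open>q = z T\<^sup>2\<^sup>d\<close>. Both claims amount to \<open>\<rho>\<^sub>j = q (1 - \<Prod>\<^sub>l (1 - \<rho>\<^sub>j\<^sub>+\<^sub>l))\<close>, which is compared
  coefficientwise. Every \<open>\<alpha>\<^sub>n\<close> is a scalar times the \<open>n\<close>-th monomial, because the factor of \<open>\<alpha>\<^sub>n\<close> in
  the recursion cannot vanish: all small solutions have order \<open>1/d\<close>. Hence for exponents with two
  nonzero coordinates the coefficient identity is the recursion itself.

  For exponents on the axis of \<open>X = X\<^sub>i\<close>, all other indeterminates may be set to zero. With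
  \<open>U\<^sub>j = 1 - u X\<^sup>j t\<close>, where \<open>t\<close> is the remaining indeterminate and
  \<open>u = X / ((1 - X) (1 - X\<^sup>d\<^sup>+\<^sup>1))\<close>, the series sums to
  \<open>1 - \<rho>\<^sub>j = U\<^sub>j\<^sub>-\<^sub>1 U\<^sub>j\<^sub>+\<^sub>d\<^sub>+\<^sub>1 / (U\<^sub>j U\<^sub>j\<^sub>+\<^sub>d)\<close>. The product over \<open>l\<close> telescopes, and what remains,
  \<open>U\<^sub>j\<^sub>-\<^sub>1 U\<^sub>j\<^sub>+\<^sub>d\<^sub>+\<^sub>1 = (1 - q) U\<^sub>j U\<^sub>j\<^sub>+\<^sub>d + q U\<^sub>j\<^sub>-\<^sub>d\<^sub>-\<^sub>1 U\<^sub>j\<^sub>+\<^sub>2\<^sub>d\<^sub>+\<^sub>1\<close>,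
  follows from the characteristic equation.
\<close>

no_notation fps_nth (infixl \<open>$\<close> 75)  \<comment> \<open>clashes with \<^const>\<open>vec_nth\<close>\<close>

section \<open>The order of a Puiseux series\<close>

lemma puiseux_order_mult:
  assumes "x \<noteq> 0" "y \<noteq> 0"
  shows "puiseux_order (x * y) = puiseux_order x + puiseux_order y"
  using assms
proof (transfer, clarsimp simp: puiseux_rel_def fls_compose_power_one_right)
  fix m k :: nat and f g :: "complex fls"
  assume "0 < m" "0 < k" "f \<noteq> 0" "g \<noteq> 0"
  then show "rat_of_int (fls_subdegree (fls_compose_power f k * fls_compose_power g m)) /
      (rat_of_nat m * rat_of_nat k) =
      rat_of_int (fls_subdegree f) / rat_of_nat m + rat_of_int (fls_subdegree g) / rat_of_nat k"
    by (simp add: fls_compose_power_eq_0_iff fls_subdegree_compose_power field_simps)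
qed

lemma puiseux_order_0 [simp]: "puiseux_order 0 = 0"
  by transfer simp

lemma puiseux_order_1 [simp]: "puiseux_order 1 = 0"
  by transfer simp

lemma puiseux_order_one_minus:
  assumes "0 < puiseux_order y"
  shows "puiseux_order (1 - y) = 0"
proof -
  have "puiseux_order (1 + - y) = 0"
    using assms
  proof (transfer, clarsimp simp: puiseux_rel_def fls_compose_power_one_right)
    fix m :: nat and f :: "complex fls"
    assume "0 < m" "0 < rat_of_int (fls_subdegree f) / rat_of_nat m"
    then have "0 < fls_subdegree f"
      by (simp add: zero_less_divide_iff)
    then show "fls_subdegree (1 - f) = 0"
      by (intro fls_subdegree_eqI) auto
  qed
  then show ?thesis by simp
qed

lemma puiseux_order_prod:
  assumes "finite A" "\<And>i. i \<in> A \<Longrightarrow> f i \<noteq> 0"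
  shows "puiseux_order (prod f A) = (\<Sum>i\<in>A. puiseux_order (f i))"
  using assms by (induction A) (auto simp: puiseux_order_mult)

lemma puiseux_order_power: "puiseux_order (x ^ n) = of_nat n * puiseux_order x"
proof (cases "x = 0")
  case False
  then show ?thesis
    using puiseux_order_prod[of "{..<n}" "\<lambda>_. x"] by simp
qed (auto simp: power_0_left)

lemma puiseux_order_of_fps:
  assumes "fps_nth f 0 \<noteq> 0"
  shows "puiseux_order (puiseux_of_fps f) = 0" and "puiseux_of_fps f \<noteq> 0"
proof -
  show "puiseux_order (puiseux_of_fps f) = 0"
    using assms by transfer (simp add: fls_subdegree_fls_to_fps subdegree_eq_0_iff)
  show "puiseux_of_fps f \<noteq> 0"
    using assms by transfer (auto simp: puiseux_rel_def fls_compose_power_one_right)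
qed

lemma puiseux_order_z: "puiseux_order puiseux_z = 1" "puiseux_z \<noteq> 0"
proof -
  show *: "puiseux_order puiseux_z = 1"
    unfolding puiseux_z_def by transfer (simp add: fls_subdegree_fls_to_fps)
  then show "puiseux_z \<noteq> 0" by auto
qed

lemma puiseux_of_fps_hom:
  "puiseux_of_fps 1 = 1"
  "puiseux_of_fps (f + g) = puiseux_of_fps f + puiseux_of_fps g"
  "puiseux_of_fps (f * g) = puiseux_of_fps f * puiseux_of_fps g"
  "puiseux_of_fps (f ^ n) = puiseux_of_fps f ^ n"
proof -
  show 1: "puiseux_of_fps 1 = 1"
    by transfer (simp add: puiseux_rel_def)
  show "puiseux_of_fps (f + g) = puiseux_of_fps f + puiseux_of_fps g"
    by transfer (simp add: puiseux_rel_def fls_compose_power_one_right)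
  show 2: "puiseux_of_fps (f * g) = puiseux_of_fps f * puiseux_of_fps g" for f g
    by transfer (simp add: puiseux_rel_def fls_compose_power_one_right fls_times_fps_to_fls)
  show "puiseux_of_fps (f ^ n) = puiseux_of_fps f ^ n"
    by (induction n) (simp_all add: 1 2)
qed

section \<open>Polynomial form of the characteristic equation and the order of its small
  solutions\<close>

lemma sum_powi_symmetric:
  fixes x :: "'a :: field"
  assumes "x \<noteq> 0"
  shows "x ^ d * (\<Sum>l\<in>{-int d..int d}. x powi l) * (1 - x) = 1 - x ^ (2 * d + 1)"
proof -
  have "x ^ d * (\<Sum>l\<in>{-int d..int d}. x powi l) = (\<Sum>l\<in>{-int d..int d}. x powi (int d + l))"
    using assms by (simp add: sum_distrib_left power_int_add)
  also have "\<dots> = (\<Sum>k<2 * d + 1. x ^ k)"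
    by (rule sum.reindex_bij_witness[of _ "\<lambda>k. int k - int d" "\<lambda>l. nat (int d + l)"])
      (auto simp: power_int_def)
  finally show ?thesis
    by (simp only: one_diff_power_eq mult.commute)
qed

text \<open>Multiplying the characteristic equation by \<open>x ^ d * (1 - x)\<close> gives the
  polynomial form. In it \<open>q\<close> has order 1 and every \<open>1 - x ^ k\<close> with
  \<open>k > 0\<close> has order 0, so \<open>d\<close> times the order of \<open>x\<close> is
  1.\<close>

lemma small_solutions_props:
  assumes "x \<in> small_solutions d T" "fps_nth T 0 \<noteq> 0" "d > 0"
  defines "q \<equiv> puiseux_z * puiseux_of_fps T ^ (2 * d)"
  shows "x \<noteq> 0" "q * (1 - x ^ (2 * d + 1)) = x ^ d * (1 - x)" "puiseux_order x = 1 / of_nat d"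
proof -
  have pos: "0 < puiseux_order x" and eq: "1 = q * (\<Sum>l\<in>{-int d..int d}. x powi l)"
    using assms by (auto simp: small_solutions_def)
  \<comment> \<open>The zero series has order 0 by convention, so a positive order excludes
    it.\<close>
  show [simp]: "x \<noteq> 0" using pos by auto
  show *: "q * (1 - x ^ (2 * d + 1)) = x ^ d * (1 - x)"
    using eq by (metis (no_types, lifting) sum_powi_symmetric[OF \<open>x \<noteq> 0\<close>, of d] mult.assoc mult.commute mult.right_neutral)
  have q: "puiseux_order q = 1" "q \<noteq> 0"
    using puiseux_order_of_fps[OF assms(2)] puiseux_order_z
    by (simp_all add: q_def puiseux_order_mult puiseux_order_power)
  have ne: "1 - x ^ k \<noteq> 0" and ord: "puiseux_order (1 - x ^ k) = 0" if "k > 0" for k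
  proof -
    have k: "0 < puiseux_order (x ^ k)"
      using that pos by (simp add: puiseux_order_power)
    then show "puiseux_order (1 - x ^ k) = 0" by (rule puiseux_order_one_minus)
    show "1 - x ^ k \<noteq> 0" using k by auto
  qed
  have "puiseux_order (q * (1 - x ^ (2 * d + 1))) = 1"
    using q ne[of "2 * d + 1"] ord[of "2 * d + 1"] by (simp add: puiseux_order_mult)
  moreover have "puiseux_order (x ^ d * (1 - x)) = of_nat d * puiseux_order x"
    using ne[of 1] ord[of 1] by (simp add: puiseux_order_mult puiseux_order_power)
  ultimately have "of_nat d * puiseux_order x = 1"
    unfolding * by simp
  then show "puiseux_order x = 1 / of_nat d"
    using \<open>d > 0\<close> by (simp add: field_simps)
qed

section \<open>Power series in one variable\<close>

text \<open>\<open>W\<close> is the inverse of \<open>V\<close>, so the factors are quotients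
  \<open>V (l - 1) / V l\<close> and neighbours cancel.\<close>

lemma prod_telescope_int:
  fixes V W :: "int \<Rightarrow> 'a :: comm_monoid_mult"
  assumes "\<And>l. V l * W l = 1"
  shows "(\<Prod>l\<in>{a..a + int n}. V (l - 1) * W l) = V (a - 1) * W (a + int n)"
proof (induction n)
  case (Suc n)
  have "{a..a + int (Suc n)} = insert (a + int (Suc n)) {a..a + int n}" by auto
  then have "(\<Prod>l\<in>{a..a + int (Suc n)}. V (l - 1) * W l) =
      V (a + int n) * W (a + int (Suc n)) * (\<Prod>l\<in>{a..a + int n}. V (l - 1) * W l)"
    by simp
  also have "\<dots> = V (a + int n) * W (a + int n) * (V (a - 1) * W (a + int (Suc n)))"
    unfolding Suc by (simp only: ac_simps)
  finally show ?case by (simp add: assms)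
qed simp

text \<open>Here \<open>r j\<close> is the series with a single indeterminate left, and
  \<open>x\<close> a small solution. Quotients are written as products with the inverses
  \<open>G\<close> of \<open>U\<close>, so that the argument stays within ring identities.\<close>

lemma single_variable_equation:
  fixes x q :: "'a :: field" and d :: nat
  assumes x: "x \<noteq> 0" "1 - x \<noteq> 0" "1 - x ^ d \<noteq> 0" "1 - x ^ (d + 1) \<noteq> 0"
    and q: "q * (1 - x ^ (2 * d + 1)) = x ^ d * (1 - x)"
    and r0: "\<And>j. fps_nth (r j) 0 = 0"
    and r: "\<And>j k. k \<ge> 1 \<Longrightarrow> fps_nth (r j) k =
      x ^ (k - 1) * (1 - x ^ (k * d)) /
        ((1 - x ^ d) * (1 - x) ^ (k - 1) * (1 - x ^ (d + 1)) ^ (k - 1)) * x powi (j * int k)"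
  shows "r j = fps_const q * (1 - (\<Prod>l\<in>{-int d..int d}. 1 - r (j + l)))"
proof -
  \<comment> \<open>The prescribed coefficients equal
    \<open>A * u ^ k * (1 - x ^ (k * d)) * x powi (j * int k)\<close>. They are thus differences of
    two geometric progressions with ratios \<open>u * x powi j\<close> and
    \<open>u * x powi (j + int d)\<close>, whose generating functions are \<open>G j\<close> and
    \<open>G (j + int d)\<close>. At \<open>k = 0\<close> the two cancel.\<close>
  define u where "u = x / ((1 - x) * (1 - x ^ (d + 1)))"
  define A where "A = (1 - x) * (1 - x ^ (d + 1)) / (x * (1 - x ^ d))"
  define U where "U j = 1 - fps_const (u * x powi j) * fps_X" for j
  define G where "G j = Abs_fps (\<lambda>k. (u * x powi j) ^ k)" for j
  have UG: "U j * G j = 1" for j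
  proof (rule fps_ext)
    fix k show "fps_nth (U j * G j) k = fps_nth 1 k"
      by (cases k) (simp_all add: U_def G_def algebra_simps)
  qed
  have rG: "r j = fps_const A * (G j - G (j + int d))" for j
  proof (rule fps_ext)
    fix k show "fps_nth (r j) k = fps_nth (fps_const A * (G j - G (j + int d))) k"
    proof (cases k)
      case 0
      then show ?thesis by (simp add: r0 G_def)
    next
      case (Suc m)
      have "(u * x powi (j + int d)) ^ k = (u * x powi j) ^ k * x ^ (k * d)"
        using x by (simp add: power_int_add power_mult_distrib mult.commute flip: power_mult)
      then have "fps_nth (fps_const A * (G j - G (j + int d))) k =
          A * ((u * x powi j) ^ k - (u * x powi j) ^ k * x ^ (k * d))"
        by (simp add: G_def)
      also have "\<dots> = A * u ^ k * (1 - x ^ (k * d)) * x powi (j * int k)"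
        by (simp add: power_mult_distrib power_int_mult right_diff_distrib left_diff_distrib ac_simps)
      also have "A * u ^ k = x ^ (k - 1) / ((1 - x ^ d) * (1 - x) ^ (k - 1) * (1 - x ^ (d + 1)) ^ (k - 1))"
        unfolding A_def u_def power_divide power_mult_distrib using x Suc
        by (simp only: power_Suc diff_Suc_1) (simp add: divide_simps)
      finally show ?thesis using Suc by (simp add: r)
    qed
  qed
  have cancel: "a = b * (G j * G i)" if "a * (U j * U i) = b" for a b i j
  proof -
    have "b * (G j * G i) = a * ((U j * G j) * (U i * G i))"
      unfolding that[symmetric] by (simp only: ac_simps)
    then show ?thesis by (simp add: UG)
  qed
  \<comment> \<open>Over the common denominator \<open>U j * U (j + int d)\<close> the numerator of
    \<open>1 - r j\<close> is quadratic in the variable and factors as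
    \<open>U (j - 1) * U (j + int d + 1)\<close>.\<close>
  have factor: "1 - r j = U (j - 1) * G j * (U (j + int d + 1) * G (j + int d))" for j
  proof -
    have e: "r j * (U j * U (j + int d)) = fps_const A * (U (j + int d) - U j)"
    proof -
      have "r j * (U j * U (j + int d)) =
          fps_const A * ((U j * G j) * U (j + int d) - (U (j + int d) * G (j + int d)) * U j)"
        unfolding rG by (simp only: algebra_simps)
      then show ?thesis by (simp add: UG)
    qed
    have Au: "A * u * (1 - x ^ d) = 1"
      using x by (simp add: A_def u_def)
    have u: "u * ((1 - x) * (1 - x ^ (d + 1))) = x"
      using x by (simp add: u_def)
    have "(1 - r j) * (U j * U (j + int d)) = U (j - 1) * U (j + int d + 1)"
    proof -
      have "(1 - r j) * (U j * U (j + int d)) =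
          U j * U (j + int d) - fps_const A * (U (j + int d) - U j)"
        by (simp add: left_diff_distrib e)
      also have "\<dots> = U j * U (j + int d) - fps_const (x powi j) * fps_X"
      proof -
        have "fps_const A * (U (j + int d) - U j) = fps_const (A * u * (1 - x ^ d) * x powi j) * fps_X"
          using x by (simp add: U_def fps_eq_iff power_int_add algebra_simps)
        then show ?thesis by (simp add: Au)
      qed
      also have "\<dots> = 1 - fps_const (u * x powi j + u * x powi (j + int d) + x powi j) * fps_X
          + fps_const (u * x powi j * (u * x powi (j + int d))) * fps_X ^ 2"
        by (simp add: U_def algebra_simps power2_eq_square
            flip: fps_const_add fps_const_mult)
      \<comment> \<open>The linear coefficients agree because
        \<open>u * ((1 - x) * (1 - x ^ (d + 1))) = x\<close>, the quadratic ones because both pairs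
        of indices sum to \<open>2 * j + int d\<close>.\<close>
      also have "u * x powi j + u * x powi (j + int d) + x powi j =
          u * x powi (j - 1) + u * x powi (j + int d + 1)"
      proof -
        have "x * x powi j = u * ((1 - x) * (1 - x ^ (d + 1))) * x powi j"
          by (simp only: u)
        then have "x * (u * x powi j + u * x powi (j + int d) + x powi j) =
          x * (u * x powi (j - 1) + u * x powi (j + int d + 1))"
          using x by (simp add: power_int_add power_int_diff algebra_simps)
        then show ?thesis using x by simp
      qed
      also have "u * x powi j * (u * x powi (j + int d)) = u * x powi (j - 1) * (u * x powi (j + int d + 1))"
        using x by (simp add: power_int_add power_int_diff field_simps)
      also have "1 - fps_const (u * x powi (j - 1) + u * x powi (j + int d + 1)) * fps_X
          + fps_const (u * x powi (j - 1) * (u * x powi (j + int d + 1))) * fps_X ^ 2 =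
          U (j - 1) * U (j + int d + 1)"
        by (simp add: U_def algebra_simps power2_eq_square
            flip: fps_const_add fps_const_mult)
      finally show ?thesis .
    qed
    from cancel[OF this] show ?thesis by (simp only: ac_simps)
  qed
  have prod1: "(\<Prod>l\<in>{-int d..int d}. U (j + l - 1) * G (j + l)) = U (j - int d - 1) * G (j + int d)"
    using prod_telescope_int[of "\<lambda>l. U (j + l)" "\<lambda>l. G (j + l)" "- int d" "2 * d"] UG
    by (simp add: algebra_simps)
  \<comment> \<open>Here the inverse carries the lower index, so \<open>G\<close> takes the role of
    \<open>V\<close> and \<open>U\<close> that of \<open>W\<close>.\<close>
  have prod2: "(\<Prod>l\<in>{-int d..int d}. U (j + l + int d + 1) * G (j + l + int d)) =
      U (j + 2 * int d + 1) * G j"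
    using prod_telescope_int[of "\<lambda>l. G (j + l + int d + 1)" "\<lambda>l. U (j + l + int d + 1)" "- int d" "2 * d"] UG
    by (simp add: algebra_simps)
  have prod: "(\<Prod>l\<in>{-int d..int d}. 1 - r (j + l)) =
      U (j - int d - 1) * U (j + 2 * int d + 1) * (G j * G (j + int d))"
  proof -
    have "(\<Prod>l\<in>{-int d..int d}. 1 - r (j + l)) =
        (\<Prod>l\<in>{-int d..int d}. U (j + l - 1) * G (j + l) * (U (j + l + int d + 1) * G (j + l + int d)))"
      by (simp only: factor)
    also have "\<dots> = (\<Prod>l\<in>{-int d..int d}. U (j + l - 1) * G (j + l)) *
        (\<Prod>l\<in>{-int d..int d}. U (j + l + int d + 1) * G (j + l + int d))"
      by (rule prod.distrib)
    finally show ?thesis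
      unfolding prod1 prod2 by (simp only: ac_simps)
  qed
  \<comment> \<open>The identity left after telescoping is quadratic in the variable. Its constant
    terms agree trivially, and its quadratic terms because all three pairs of indices sum to
    \<open>2 * j + int d\<close>. This is the linear coefficient, up to the factor
    \<open>-u\<close>.\<close>
  have lin: "x powi (j - 1) + x powi (j + int d + 1) =
      (1 - q) * (x powi j + x powi (j + int d)) + q * (x powi (j - int d - 1) + x powi (j + 2 * int d + 1))"
  proof -
    define a b where "a = x powi j" and "b = x ^ d"
    have b: "b \<noteq> 0" using x by (simp add: b_def)
    have b2: "x powi (2 * int d) = b * b"
      using x unfolding mult_2 b_def by (subst power_int_add) auto
    have b3: "x ^ (2 * d + 1) = b * b * x"
      unfolding mult_2 power_add b_def by simp
    have powi: "x powi (j - 1) = a / x" "x powi (j + int d + 1) = a * b * x" "x powi (j + int d) = a * b"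
        "x powi (j - int d - 1) = a / (b * x)" "x powi (j + 2 * int d + 1) = a * (b * b) * x"
      using x b2 by (simp_all add: power_int_add power_int_diff a_def b_def)
    \<comment> \<open>After multiplication by \<open>b * x\<close>, the left difference becomes
      \<open>a * b * (1 - x) * (1 - b * x)\<close>, and the one next to \<open>q\<close> becomes
      \<open>a * (1 - b * b * x) * (1 - b * x)\<close>. The characteristic equation links the
      two.\<close>
    have "b * x * (a / x + a * b * x - (a + a * b)) = a * (b * (1 - x)) * (1 - b * x)"
      using x by (simp add: field_simps)
    also have "b * (1 - x) = q * (1 - b * b * x)"
      using q[unfolded b3] by (simp add: b_def)
    also have "a * (q * (1 - b * b * x)) * (1 - b * x) =
        b * x * (q * (a / (b * x) + a * (b * b) * x - (a + a * b)))"
      using x b by (simp add: field_simps)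
    finally have "a / x + a * b * x - (a + a * b) = q * (a / (b * x) + a * (b * b) * x - (a + a * b))"
      using x b by (simp only: mult_left_cancel mult_eq_0_iff simp_thms)
    then show ?thesis
      unfolding powi a_def[symmetric] by (simp add: algebra_simps)
  qed
  have "U (j - 1) * U (j + int d + 1) = fps_const (1 - q) * (U j * U (j + int d))
      + fps_const q * (U (j - int d - 1) * U (j + 2 * int d + 1))"
  proof -
    have expand: "U a * U b = 1 - fps_const (u * (x powi a + x powi b)) * fps_X
        + fps_const (u\<^sup>2 * x powi (a + b)) * fps_X ^ 2" for a b
      using x by (simp add: U_def algebra_simps power2_eq_square power_int_add
            flip: fps_const_add fps_const_mult)
    have "U (j - 1) * U (j + int d + 1) = 1 - fps_const (u * (x powi (j - 1) + x powi (j + int d + 1))) * fps_X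
        + fps_const (u\<^sup>2 * x powi (2 * j + int d)) * fps_X ^ 2"
      by (simp add: expand)
    also note lin
    finally show ?thesis
      by (simp add: expand algebra_simps flip: fps_const_add fps_const_sub fps_const_mult)
  qed
  then have "1 - r j = (fps_const (1 - q) * (U j * U (j + int d))
      + fps_const q * (U (j - int d - 1) * U (j + 2 * int d + 1))) * (G j * G (j + int d))"
    using factor[of j] by (simp only: ac_simps)
  also have "\<dots> = fps_const (1 - q) * ((U j * G j) * (U (j + int d) * G (j + int d))) +
      fps_const q * (\<Prod>l\<in>{-int d..int d}. 1 - r (j + l))"
    unfolding prod by (simp only: algebra_simps)
  finally show ?thesis
    unfolding UG by (simp add: algebra_simps flip: fps_const_sub)
qed

section \<open>Monomials and coefficients of power series in several variables\<close>

text \<open>Constants, powers of an indeterminate and eventually every \<open>\<alpha> n\<close>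
  have this form, so that multiplying them amounts to adding exponents.\<close>

lift_definition mps_monom :: "'a :: zero \<Rightarrow> nat ^ 'v :: finite \<Rightarrow> ('a, 'v) mps" is
  "\<lambda>c n m. if m = n then c else 0" .

lemma mps_eqI: "(\<And>n. mps_coeff f n = mps_coeff g n) \<Longrightarrow> f = g"
  by (simp add: mps_coeff_inject[symmetric] fun_eq_iff)

lemma mps_monom_mult: "mps_monom a m * mps_monom b n = mps_monom (a * b) (m + n)"
proof (rule mps_eqI)
  fix k
  have "mps_coeff (mps_monom a m * mps_monom b n) k =
      (\<Sum>pq \<in> {(p, q). p + q = k}. if pq = (m, n) then a * b else 0)"
    by (auto simp: times_mps.rep_eq mps_monom.rep_eq case_prod_unfold prod_eq_iff intro!: sum.cong)
  also have "\<dots> = mps_coeff (mps_monom (a * b) (m + n)) k"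
    by (auto simp: finite_vec_splits mps_monom.rep_eq)
  finally show "mps_coeff (mps_monom a m * mps_monom b n) k = mps_coeff (mps_monom (a * b) (m + n)) k" .
qed

lemma mps_const_conv_monom: "mps_const c = mps_monom c 0"
  by (rule mps_eqI) (simp add: mps_const.rep_eq mps_monom.rep_eq)

lemma mps_one_conv_monom: "1 = mps_monom 1 0"
  by (rule mps_eqI) (simp add: one_mps.rep_eq mps_monom.rep_eq)

lemma mps_var_conv_monom: "mps_var v = mps_monom 1 (axis v 1)"
  by (rule mps_eqI) (simp add: mps_var.rep_eq mps_monom.rep_eq)

lemma mps_var_power: "mps_var v ^ k = mps_monom 1 (axis v k)"
proof (induction k)
  case 0
  then show ?case by (simp add: mps_one_conv_monom axis_def zero_vec_def)
next
  case (Suc k)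
  have "axis v 1 + axis v k = axis v (Suc k)"
    by (simp add: vec_eq_iff axis_def)
  then show ?case by (simp add: Suc) (simp add: mps_var_conv_monom mps_monom_mult)
qed

lemma mps_monom_prod:
  "(\<Prod>i\<in>A. mps_monom (c i) (e i)) = mps_monom (\<Prod>i\<in>A. c i) (\<Sum>i\<in>A. e i)"
proof (cases "finite A")
  case True
  then show ?thesis
    by (induction A) (simp_all add: mps_one_conv_monom mps_monom_mult)
qed (simp add: mps_one_conv_monom)

lemma mps_coeff_sum: "mps_coeff (\<Sum>i\<in>A. f i) n = (\<Sum>i\<in>A. mps_coeff (f i) n)"
  by (induction A rule: infinite_finite_induct) (simp_all add: zero_mps.rep_eq plus_mps.rep_eq)

lemma mps_coeff_const_mult:
  fixes f :: "('a :: comm_ring_1, 'v :: finite) mps"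
  shows "mps_coeff (mps_const c * f) n = c * mps_coeff f n"
proof -
  have "mps_coeff (mps_const c * f) n =
      (\<Sum>(p, q) \<in> {(0, n)}. mps_coeff (mps_const c :: ('a, 'v) mps) p * mps_coeff f q)"
    unfolding times_mps.rep_eq
    by (rule sum.mono_neutral_right) (auto simp: finite_vec_splits mps_const.rep_eq split: if_splits)
  then show ?thesis by (simp add: mps_const.rep_eq)
qed

lemma mps_coeff_mult_const: "mps_coeff (f * mps_const c) n = mps_coeff f n * c"
  using mps_coeff_const_mult[of c f n] by (simp add: mult.commute)

lemma mps_const_hom:
  "mps_const 1 = (1 :: ('a :: comm_ring_1, 'v :: finite) mps)"
  "mps_const (a + b) = (mps_const a + mps_const b :: ('a, 'v) mps)"
  "mps_const (a * b) = (mps_const a * mps_const b :: ('a, 'v) mps)"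
  "mps_const (a ^ n) = (mps_const a ^ n :: ('a, 'v) mps)"
proof -
  show 1: "mps_const 1 = (1 :: ('a :: comm_ring_1, 'v :: finite) mps)"
    by (simp add: mps_const_conv_monom mps_one_conv_monom)
  show "mps_const (a + b) = (mps_const a + mps_const b :: ('a, 'v) mps)"
    by (rule mps_eqI) (simp add: mps_const.rep_eq plus_mps.rep_eq)
  show 2: "mps_const (a * b) = (mps_const a * mps_const b :: ('a, 'v) mps)" for a b
    by (simp add: mps_const_conv_monom mps_monom_mult)
  show "mps_const (a ^ n) = (mps_const a ^ n :: ('a, 'v) mps)"
    by (induction n) (simp_all add: 1 2)
qed

lemma mps_coeff_uminus_one_power: "mps_coeff ((- 1) ^ k * f) n = (- 1) ^ k * mps_coeff f n"
  using mps_coeff_const_mult[of "(- 1) ^ k" f n]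
  by (cases "even k") (simp_all add: uminus_mps.rep_eq)

section \<open>Coefficients of finite products\<close>

lemma finite_vec_lists: "finite {gs. length gs = l \<and> sum_list gs = (n :: nat ^ 'v :: finite)}"
proof (rule finite_subset)
  have "set gs \<subseteq> {p. p \<le> sum_list gs}" for gs :: "(nat ^ 'v) list"
  proof (induction gs)
    case (Cons g gs)
    then show ?case by (auto simp: less_eq_vec_def trans_le_add2)
  qed simp
  then show "{gs. length gs = l \<and> sum_list gs = n} \<subseteq> {gs. set gs \<subseteq> {p. p \<le> n} \<and> length gs = l}"
    by auto
  show "finite {gs. set gs \<subseteq> {p. p \<le> n} \<and> length gs = l}"
    by (rule finite_lists_length_eq) (rule finite_vec_le)
qed

text \<open>Iterated convolution: the factor at position \<open>k\<close> contributes the exponent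
  \<open>gs ! k\<close>. Zero vectors may occur in the lists, unlike in
  \<open>vec_compositions\<close>.\<close>

lemma mps_coeff_prod:
  "mps_coeff (\<Prod>k<l. f k) n =
    (\<Sum>gs | length gs = l \<and> sum_list gs = n. \<Prod>k<l. mps_coeff (f k) (gs ! k))"
proof (induction l arbitrary: n)
  case 0
  have "{gs. length gs = 0 \<and> sum_list gs = n} = (if n = 0 then {[]} else {})" by auto
  then show ?case by (simp only:) (simp add: one_mps.rep_eq)
next
  case (Suc l)
  let ?L = "\<lambda>l n. {gs. length gs = l \<and> sum_list gs = n}"
  let ?S = "{(p, q). p + q = n}"
  have "mps_coeff (\<Prod>k<Suc l. f k) n =
      (\<Sum>(p, q)\<in>?S. (\<Sum>gs\<in>?L l p. \<Prod>k<l. mps_coeff (f k) (gs ! k)) * mps_coeff (f l) q)"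
    by (simp add: times_mps.rep_eq Suc)
  also have "\<dots> = (\<Sum>pq\<in>?S. \<Sum>gs\<in>?L l (fst pq).
      (\<Prod>k<l. mps_coeff (f k) (gs ! k)) * mps_coeff (f l) (snd pq))"
    by (simp add: case_prod_unfold sum_distrib_right)
  also have "\<dots> = (\<Sum>(pq, gs)\<in>(SIGMA pq : ?S. ?L l (fst pq)).
      (\<Prod>k<l. mps_coeff (f k) (gs ! k)) * mps_coeff (f l) (snd pq))"
    by (rule sum.Sigma) (auto simp: finite_vec_splits finite_vec_lists)
  also have "\<dots> = (\<Sum>gs\<in>?L (Suc l) n. \<Prod>k<Suc l. mps_coeff (f k) (gs ! k))"
  \<comment> \<open>The product grows at its upper end, so it is the last list entry that is split
    off.\<close>
  proof (rule sum.reindex_bij_witness[of _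
        "\<lambda>gs. ((sum_list (butlast gs), last gs), butlast gs)" "\<lambda>((p, q), gs). gs @ [q]"])
    fix gs assume "gs \<in> ?L (Suc l) n"
    then have *: "gs \<noteq> []" "length gs = Suc l" "sum_list gs = n" by auto
    then show "((sum_list (butlast gs), last gs), butlast gs) \<in> (SIGMA pq : ?S. ?L l (fst pq))"
      using append_butlast_last_id[OF *(1)] sum_list_append[of "butlast gs" "[last gs]"] by auto
  qed (auto simp: nth_append intro!: append_butlast_last_id)
  finally show ?case .
qed

text \<open>Passes from a product over a set of shifts to the indexing by rank used in
  \<open>alpha_family\<close>.\<close>

lemma prod_conv_sorted_nth:
  assumes "finite B"
  shows "(\<Prod>b\<in>B. f b) = (\<Prod>k<card B. f (sorted_list_of_set B ! k))"
  using prod.reindex_bij_betw[OF bij_betw_nth[of "sorted_list_of_set B" "{..<card B}" B], of f] assms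
  by simp

section \<open>Setting all indeterminates but one to zero\<close>

lift_definition mps_axis_fps :: "'v :: finite \<Rightarrow> ('a :: comm_ring_1, 'v) mps \<Rightarrow> 'a fps" is
  "\<lambda>i f. Abs_fps (\<lambda>k. f (axis i k))" .

lemma nth_mps_axis_fps [simp]: "fps_nth (mps_axis_fps i f) k = mps_coeff f (axis i k)"
  by (simp add: mps_axis_fps.rep_eq)

text \<open>A sum of vectors of natural numbers lies on an axis only if both summands do, so the
  convolution at axis exponents involves axis coefficients only.\<close>

lemma mps_axis_fps_mult: "mps_axis_fps i (f * g) = mps_axis_fps i f * mps_axis_fps i g"
proof (rule fps_ext)
  fix k
  have "(\<Sum>(p, q) | p + q = axis i k. mps_coeff f p * mps_coeff g q) =
      (\<Sum>m=0..k. mps_coeff f (axis i m) * mps_coeff g (axis i (k - m)))"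
  proof (rule sum.reindex_bij_witness[of _ "\<lambda>m. (axis i m, axis i (k - m))" "\<lambda>(p, q). p $ i"])
    fix pq assume "pq \<in> {(p, q). p + q = axis i k}"
    then obtain p q where [simp]: "pq = (p, q)" and pq: "p + q = axis i k" by auto
    have *: "p $ j + q $ j = (if j = i then k else 0)" for j
      using arg_cong[OF pq, of "\<lambda>v. v $ j"] by (simp add: axis_def)
    have "axis i (p $ i) $ j = p $ j" "axis i (k - p $ i) $ j = q $ j" for j
      using *[of j] by (auto simp: axis_def split: if_splits)
    then have 1: "axis i (p $ i) = p" "axis i (k - p $ i) = q"
      unfolding vec_eq_iff by blast+
    moreover have "p $ i \<le> k"
      using *[of i] by simp
    ultimately show "(axis i ((case pq of (p, q) \<Rightarrow> p $ i)), axis i (k - (case pq of (p, q) \<Rightarrow> p $ i))) = pq"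
      and "(case pq of (p, q) \<Rightarrow> p $ i) \<in> {0..k}"
      by simp_all
    show "mps_coeff f (axis i (case pq of (p, q) \<Rightarrow> p $ i)) * mps_coeff g (axis i (k - (case pq of (p, q) \<Rightarrow> p $ i)))
      = (case pq of (p, q) \<Rightarrow> mps_coeff f p * mps_coeff g q)"
      by (simp add: 1)
  qed (auto simp: vec_eq_iff axis_def)
  then show "fps_nth (mps_axis_fps i (f * g)) k = fps_nth (mps_axis_fps i f * mps_axis_fps i g) k"
    by (simp add: times_mps.rep_eq fps_mult_nth)
qed

lemma axis_eq_0_iff: "axis i k = 0 \<longleftrightarrow> k = (0 :: nat)"
  by (auto simp: vec_eq_iff axis_def)

lemma mps_axis_fps_1: "mps_axis_fps i 1 = 1"
  by (rule fps_ext) (simp add: one_mps.rep_eq axis_eq_0_iff)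

lemma mps_axis_fps_diff: "mps_axis_fps i (f - g) = mps_axis_fps i f - mps_axis_fps i g"
  by (rule fps_ext) (simp add: minus_mps.rep_eq)

lemma mps_axis_fps_const: "mps_axis_fps i (mps_const c) = fps_const c"
  by (rule fps_ext) (simp add: mps_const.rep_eq axis_eq_0_iff)

lemma mps_axis_fps_prod: "mps_axis_fps i (\<Prod>a\<in>A. f a) = (\<Prod>a\<in>A. mps_axis_fps i (f a))"
  by (induction A rule: infinite_finite_induct) (simp_all add: mps_axis_fps_1 mps_axis_fps_mult)

text \<open>The product expands over subsets, which are then grouped by size. This converts between
  the product form and the alternating-sum form of the equation.\<close>

lemma prod_one_minus:
  fixes f :: "'b \<Rightarrow> 'a :: comm_ring_1"
  assumes "finite A"
  shows "1 - (\<Prod>a\<in>A. 1 - f a) =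
    (\<Sum>l=1..card A. (- 1) ^ (l - 1) * (\<Sum>B | B \<subseteq> A \<and> card B = l. \<Prod>b\<in>B. f b))"
proof -
  let ?e = "\<lambda>l. \<Sum>B | B \<subseteq> A \<and> card B = l. \<Prod>b\<in>B. f b"
  have "(\<Prod>a\<in>A. 1 - f a) = (\<Sum>B\<in>Pow A. \<Prod>b\<in>B. - f b)"
    using prod_add[OF assms, of "\<lambda>a. - f a" "\<lambda>_. 1"] by simp
  also have "\<dots> = (\<Sum>B\<in>Pow A. (- 1) ^ card B * (\<Prod>b\<in>B. f b))"
    by (simp add: prod_uminus)
  also have "\<dots> = (\<Sum>l\<in>{0..card A}. \<Sum>B\<in>{B \<in> Pow A. card B = l}. (- 1) ^ card B * (\<Prod>b\<in>B. f b))"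
    by (rule sum.group[symmetric]) (auto simp: assms card_mono)
  also have "\<dots> = (\<Sum>l\<in>{0..card A}. (- 1) ^ l * ?e l)"
    by (intro sum.cong) (auto simp: sum_distrib_left intro!: sum.cong)
  \<comment> \<open>The empty subset gives the term \<open>l = 0\<close>, which cancels against the
    1 in the claim.\<close>
  also have "\<dots> = 1 + (\<Sum>l=1..card A. (- 1) ^ l * ?e l)"
  proof -
    have "{B. B \<subseteq> A \<and> card B = 0} = {{}}"
      using assms by (auto dest: finite_subset)
    then show ?thesis
      by (simp add: sum.atLeast_Suc_atMost)
  qed
  also have "(\<Sum>l=1..card A. (- 1) ^ l * ?e l) = - (\<Sum>l=1..card A. (- 1) ^ (l - 1) * ?e l)"
    unfolding sum_negf[symmetric]
    by (intro sum.cong) (auto simp: Suc_le_eq gr0_conv_Suc)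
  finally show ?thesis by simp
qed

section \<open>The series \<open>\<rho>\<^sub>j\<close>\<close>

lemma X_pow_0_right [simp]: "X_pow X m 0 = 1"
  by (simp add: X_pow_def)

lemma X_pow_axis: "X_pow X m (axis l k) = X l powi (m * int k)"
proof -
  have "X_pow X m (axis l k) = (\<Prod>i\<in>UNIV. if i = l then X l powi (m * int k) else 1)"
    unfolding X_pow_def by (intro prod.cong) (auto simp: axis_def)
  then show ?thesis by simp
qed

lemma X_pow_add_left:
  assumes "\<And>l. X l \<noteq> 0"
  shows "X_pow X (a + b) n = X_pow X a n * X_pow X b n"
  using assms by (simp add: X_pow_def power_int_add distrib_right prod.distrib)

lemma X_pow_add_right:
  assumes "\<And>l. X l \<noteq> 0"
  shows "X_pow X m (p + q) = X_pow X m p * X_pow X m q"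
  using assms by (simp add: X_pow_def power_int_add distrib_left prod.distrib)

lemma X_pow_sum:
  assumes "\<And>l. X l \<noteq> 0"
  shows "X_pow X m (\<Sum>k\<in>A. f k) = (\<Prod>k\<in>A. X_pow X m (f k))"
  by (induction A rule: infinite_finite_induct) (simp_all add: X_pow_add_right assms)

text \<open>Lets the sum of \<open>X_pow X l n\<close> over \<open>l\<close> be read as the sum in
  the characteristic equation at the single element \<open>X_pow X 1 n\<close>.\<close>

lemma X_pow_conv_powi: "X_pow X m n = X_pow X 1 n powi m"
proof -
  have prod: "(\<Prod>i\<in>A. X i powi int (n $ i)) powi m = (\<Prod>i\<in>A. (X i powi int (n $ i)) powi m)" for A
    by (induction A rule: infinite_finite_induct) (simp_all add: power_int_mult_distrib)
  have "X_pow X 1 n = (\<Prod>i\<in>UNIV. X i powi int (n $ i))"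
    by (simp add: X_pow_def)
  then show ?thesis
    unfolding X_pow_def[of X m] by (simp only: prod power_int_mult mult.commute[of m])
qed

text \<open>At least one further part remains, and it is nonzero. This makes the coordinate sum a
  measure for induction along the recursion.\<close>

lemma vec_compositions_size_less:
  fixes n :: "nat ^ 'v :: finite"
  assumes "gs \<in> vec_compositions l n" "l \<ge> 2" "k < l"
  shows "(\<Sum>i\<in>UNIV. gs ! k $ i) < (\<Sum>i\<in>UNIV. n $ i)"
proof -
  define sz where "sz g = (\<Sum>i\<in>UNIV. g $ i)" for g :: "nat ^ 'v"
  have pos: "sz (gs ! m) > 0" if "m < l" for m
  proof -
    have "gs ! m \<in> set gs" "0 \<notin> set gs" using assms(1) that by (auto simp: vec_compositions_def)
    then have "gs ! m \<noteq> 0" by metis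
    then show ?thesis by (auto simp: sz_def vec_eq_iff intro!: sum_pos2)
  qed
  have "n = (\<Sum>m<l. gs ! m)"
    using assms(1) by (auto simp: vec_compositions_def sum_list_sum_nth atLeast0LessThan)
  then have "sz n = (\<Sum>m<l. sz (gs ! m))"
    by (simp add: sz_def sum.swap[of _ UNIV])
  also have "\<dots> = sz (gs ! k) + (\<Sum>m\<in>{..<l} - {k}. sz (gs ! m))"
    using assms(3) by (subst sum.remove[of _ k]) auto
  also have "\<dots> > sz (gs ! k)"
  proof -
    \<comment> \<open>An index other than \<open>k\<close>; it is in range because
      \<open>l \<ge> 2\<close>.\<close>
    have "(if k = 0 then 1 else 0) \<in> {..<l} - {k}" using assms(2) by auto
    then have "(\<Sum>m\<in>{..<l} - {k}. sz (gs ! m)) > 0"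
      by (intro sum_pos) (auto simp: pos)
    then show ?thesis by simp
  qed
  finally show ?thesis by (simp add: sz_def)
qed

text \<open>The cases match the three clauses of \<open>alpha_family\<close>.\<close>

lemma vec_support_cases:
  fixes n :: "nat ^ 'v :: finite"
  obtains "n = 0" | l k where "n = axis l k" "k \<ge> 1" | "card {i. n $ i \<noteq> 0} \<ge> 2"
proof -
  consider "card {i. n $ i \<noteq> 0} = 0" | "card {i. n $ i \<noteq> 0} = 1" | "card {i. n $ i \<noteq> 0} \<ge> 2"
    by linarith
  then show ?thesis
  proof cases
    case 1
    then have "n = 0" by (auto simp: vec_eq_iff)
    then show ?thesis by (rule that(1))
  next
    case 2
    then obtain l where l: "{i. n $ i \<noteq> 0} = {l}" by (auto simp: card_1_singleton_iff)
    have "n $ i = axis l (n $ l) $ i" for i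
    proof (cases "i = l")
      case False
      then have "n $ i = 0" using l by blast
      then show ?thesis using False by (simp add: axis_def)
    qed (simp add: axis_def)
    then have "n = axis l (n $ l)" unfolding vec_eq_iff by blast
    moreover have "n $ l \<noteq> 0" using l by blast
    then have "n $ l \<ge> 1" by simp
    ultimately show ?thesis by (rule that(2))
  next
    case 3
    then show ?thesis by (rule that(3))
  qed
qed

section \<open>The scalars behind the family \<open>\<alpha>\<close>\<close>

locale alpha_setup =
  fixes T :: "complex fps" and X :: "'d :: finite \<Rightarrow> puiseux"
    and \<alpha> :: "nat ^ 'd \<Rightarrow> (puiseux, 'd) mps" and d :: nat
  assumes d: "d = CARD('d)"
    and T0: "fps_nth T 0 \<noteq> 0"
    and X: "bij_betw X UNIV (small_solutions d T)"
    and \<alpha>: "alpha_family T X \<alpha>"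
begin

abbreviation "q \<equiv> puiseux_z * puiseux_of_fps T ^ (2 * d)"

text \<open>The scalar in front of the \<open>n\<close>-th monomial in \<open>\<alpha> n\<close>;
  that no other monomial occurs is \<open>\<alpha>_monom\<close>.\<close>

abbreviation "c n \<equiv> mps_coeff (\<alpha> n) n"

lemma d_pos: "d > 0"
  by (simp add: d)

lemma X_small: "X l \<in> small_solutions d T"
  using X by (auto simp: bij_betw_def)

lemmas X_props = small_solutions_props[OF X_small T0 d_pos]

lemma q_nonzero: "q \<noteq> 0"
  using puiseux_order_z puiseux_order_of_fps[OF T0] by simp

lemma X_pow_1_order: "puiseux_order (X_pow X 1 n) = of_nat (\<Sum>i\<in>UNIV. n $ i) / of_nat d"
  unfolding X_pow_def using X_props(1)
  by (simp add: puiseux_order_prod puiseux_order_power X_props(3) sum_divide_distrib)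

text \<open>If the factor vanished, \<open>X_pow X 1 n\<close> would be a small solution. Its order
  is the coordinate sum of \<open>n\<close> divided by \<open>d\<close>, hence at least
  \<open>2 / d\<close>, whereas small solutions have order \<open>1 / d\<close>.\<close>

lemma kernel_nonzero:
  assumes "card {i. n $ i \<noteq> 0} \<ge> 2"
  shows "- (1 / q) + (\<Sum>l\<in>{-int d..int d}. X_pow X l n) \<noteq> 0"
proof
  assume "- (1 / q) + (\<Sum>l\<in>{-int d..int d}. X_pow X l n) = 0"
  then have "1 = q * (\<Sum>l\<in>{-int d..int d}. X_pow X l n)"
    using q_nonzero by (simp add: field_simps)
  also have "(\<Sum>l\<in>{-int d..int d}. X_pow X l n) = (\<Sum>l\<in>{-int d..int d}. X_pow X 1 n powi l)"
    by (rule sum.cong) (auto intro: X_pow_conv_powi)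
  finally have eq: "1 = q * (\<Sum>l\<in>{-int d..int d}. X_pow X 1 n powi l)" .
  have "(\<Sum>i\<in>{i. n $ i \<noteq> 0}. 1) \<le> (\<Sum>i\<in>{i. n $ i \<noteq> 0}. n $ i)"
    by (rule sum_mono) auto
  also have "\<dots> \<le> (\<Sum>i\<in>UNIV. n $ i)"
    by (rule sum_mono2) auto
  finally have size: "(\<Sum>i\<in>UNIV. n $ i) \<ge> 2"
    using assms by simp
  then have "0 < (\<Sum>i\<in>UNIV. n $ i)"
    by linarith
  then have "0 < (of_nat (\<Sum>i\<in>UNIV. n $ i) :: rat)"
    by (simp only: of_nat_0_less_iff)
  then have "puiseux_order (X_pow X 1 n) > 0"
    by (simp add: X_pow_1_order d_pos del: of_nat_sum)
  with eq have "X_pow X 1 n \<in> small_solutions d T"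
    by (simp add: small_solutions_def)
  from small_solutions_props(3)[OF this T0 d_pos] have "(of_nat (\<Sum>i\<in>UNIV. n $ i) :: rat) = of_nat 1"
    using d_pos by (simp only: X_pow_1_order) simp
  then have "(\<Sum>i\<in>UNIV. n $ i) = 1"
    by (simp only: of_nat_eq_iff)
  with size show False by simp
qed

lemma \<alpha>_0: "\<alpha> 0 = 0"
  using \<alpha> by (simp add: alpha_family_def Let_def)

lemma \<alpha>_axis:
  assumes "k \<ge> 1"
  shows "\<alpha> (axis l k) = mps_monom (X l ^ (k - 1) * (1 - X l ^ (k * d)) /
    ((1 - X l ^ d) * (1 - X l) ^ (k - 1) * (1 - X l ^ (d + 1)) ^ (k - 1))) (axis l k)"
proof -
  have "\<alpha> (axis l k) = mps_var l ^ k * mps_const (X l ^ (k - 1) * (1 - X l ^ (k * d)) /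
    ((1 - X l ^ d) * (1 - X l) ^ (k - 1) * (1 - X l ^ (d + 1)) ^ (k - 1)))"
    using \<alpha> assms unfolding alpha_family_def Let_def d[symmetric] by blast
  then show ?thesis
    by (simp only: mps_var_power mps_const_conv_monom mps_monom_mult mult_1 add_0_right)
qed

abbreviation "E l gs \<equiv> (\<Sum>B | B \<subseteq> {-int d..int d} \<and> card B = l.
  \<Prod>k<l. X_pow X (sorted_list_of_set B ! k) (gs ! k))"

lemma \<alpha>_rec:
  assumes "card {i. n $ i \<noteq> 0} \<ge> 2"
  shows "\<alpha> n * mps_const (- (1 / q) + (\<Sum>l\<in>{-int d..int d}. X_pow X l n)) =
    (\<Sum>l=2..2 * d + 1. (- 1) ^ l *
      (\<Sum>gs\<in>vec_compositions l n. (\<Prod>k<l. \<alpha> (gs ! k)) * mps_const (E l gs)))"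
  using \<alpha> assms unfolding alpha_family_def Let_def d[symmetric] by blast

text \<open>The exponents of a composition add up to \<open>n\<close>. The monomial form of the
  entries is a hypothesis so that the lemma can serve inside the induction for
  \<open>\<alpha>_monom\<close>.\<close>

lemma \<alpha>_prod_monom:
  assumes "gs \<in> vec_compositions l n" "\<And>k. k < l \<Longrightarrow> \<alpha> (gs ! k) = mps_monom (c (gs ! k)) (gs ! k)"
  shows "(\<Prod>k<l. \<alpha> (gs ! k)) = mps_monom (\<Prod>k<l. c (gs ! k)) n"
proof -
  have "(\<Prod>k<l. \<alpha> (gs ! k)) = (\<Prod>k<l. mps_monom (c (gs ! k)) (gs ! k))"
    using assms(2) by (intro prod.cong) auto
  also have "\<dots> = mps_monom (\<Prod>k<l. c (gs ! k)) n"
    using assms(1)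
    by (auto simp: mps_monom_prod vec_compositions_def sum_list_sum_nth atLeast0LessThan)
  finally show ?thesis .
qed

lemma \<alpha>_monom: "\<alpha> n = mps_monom (c n) n"
proof (induction "\<Sum>i\<in>UNIV. n $ i" arbitrary: n rule: less_induct)
  case less
  consider "n = 0" | l k where "n = axis l k" "k \<ge> 1" | "card {i. n $ i \<noteq> 0} \<ge> 2"
    by (rule vec_support_cases)
  then show ?case
  proof cases
    case 1
    then show ?thesis
      by (auto intro!: mps_eqI simp: \<alpha>_0 mps_monom.rep_eq zero_mps.rep_eq)
  next
    case 2
    then show ?thesis
      by (simp only: \<alpha>_axis) (simp add: mps_monom.rep_eq)
  next
    case 3
    let ?\<kappa> = "- (1 / q) + (\<Sum>l\<in>{-int d..int d}. X_pow X l n)"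
    \<comment> \<open>By induction the right-hand side of the recursion has coefficient 0 at
      \<open>m\<close>; the nonzero scalar on the left then cancels.\<close>
    have "mps_coeff (\<alpha> n) m = 0" if "m \<noteq> n" for m
    proof -
      have "mps_coeff (\<alpha> n * mps_const ?\<kappa>) m = (\<Sum>l=2..2 * d + 1. (- 1) ^ l *
          (\<Sum>gs\<in>vec_compositions l n. mps_coeff (\<Prod>k<l. \<alpha> (gs ! k)) m * E l gs))"
        unfolding \<alpha>_rec[OF 3] mps_coeff_sum mps_coeff_uminus_one_power mps_coeff_mult_const ..
      also have "\<dots> = 0"
      proof (intro sum.neutral ballI)
        fix l assume "l \<in> {2..2 * d + 1}"
        then have "(\<Prod>k<l. \<alpha> (gs ! k)) = mps_monom (\<Prod>k<l. c (gs ! k)) n" if "gs \<in> vec_compositions l n" for gs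
          using that less vec_compositions_size_less[OF that] by (intro \<alpha>_prod_monom) auto
        then show "(- 1) ^ l * (\<Sum>gs\<in>vec_compositions l n. mps_coeff (\<Prod>k<l. \<alpha> (gs ! k)) m * E l gs) = 0"
          using \<open>m \<noteq> n\<close> by (simp add: mps_monom.rep_eq)
      qed
      finally show ?thesis
        using kernel_nonzero[OF 3] by (simp only: mps_coeff_mult_const mult_eq_0_iff simp_thms)
    qed
    then show ?thesis
      by (auto intro!: mps_eqI simp: mps_monom.rep_eq)
  qed
qed

lemma c_0 [simp]: "c 0 = 0"
  by (simp add: \<alpha>_0 zero_mps.rep_eq)

lemma c_rec:
  assumes "card {i. n $ i \<noteq> 0} \<ge> 2"
  shows "c n * (- (1 / q) + (\<Sum>l\<in>{-int d..int d}. X_pow X l n)) =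
    (\<Sum>l=2..2 * d + 1. (- 1) ^ l * (\<Sum>gs\<in>vec_compositions l n. (\<Prod>k<l. c (gs ! k)) * E l gs))"
proof -
  have "mps_coeff (\<Prod>k<l. \<alpha> (gs ! k)) n = (\<Prod>k<l. c (gs ! k))" if "gs \<in> vec_compositions l n" for l gs
    using \<alpha>_prod_monom[OF that \<alpha>_monom] by (simp add: mps_monom.rep_eq)
  then show ?thesis
    using arg_cong[OF \<alpha>_rec[OF assms], of "\<lambda>f. mps_coeff f n"]
    unfolding mps_coeff_sum mps_coeff_uminus_one_power mps_coeff_mult_const by simp
qed

text \<open>Only the member with index \<open>n\<close> contributes at exponent \<open>n\<close>, so
  the formal infinite sum has at most one nonzero term there.\<close>

lemma coeff_rho: "mps_coeff (rho X \<alpha> j) n = c n * X_pow X j n"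
proof -
  have coeff: "mps_coeff (\<alpha> m * mps_const (X_pow X j m)) n = (if m = n then c n * X_pow X j n else 0)" for m
    unfolding mps_coeff_mult_const by (subst \<alpha>_monom) (simp add: mps_monom.rep_eq)
  show ?thesis
    unfolding rho_def mps_Sum_any.rep_eq coeff
    by (subst Sum_any.expand_superset[of "{n}"]) auto
qed

text \<open>Restriction to the axis respects all operations involved and reduces the claim to
  \<open>single_variable_equation\<close>. The value \<open>k = 0\<close> is included, which covers
  the constant coefficient.\<close>

lemma rho_axis_coeff:
  "mps_coeff (rho X \<alpha> j) (axis i k) = mps_coeff (mps_const q * (1 - (\<Prod>l\<in>{-int d..int d}. 1 - rho X \<alpha> (j + l)))) (axis i k)"
proof -
  let ?r = "\<lambda>j. mps_axis_fps i (rho X \<alpha> j)"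
  have ne: "1 - X i ^ k \<noteq> 0" if "k > 0" for k
  proof
    assume "1 - X i ^ k = 0"
    then have "puiseux_order (X i ^ k) = 0" by simp
    then show False
      using that d_pos by (simp add: puiseux_order_power X_props(3))
  qed
  have "?r j = fps_const q * (1 - (\<Prod>l\<in>{-int d..int d}. 1 - ?r (j + l)))"
  proof (rule single_variable_equation)
    show "X i \<noteq> 0" "q * (1 - X i ^ (2 * d + 1)) = X i ^ d * (1 - X i)"
      by (rule X_props)+
    show "1 - X i \<noteq> 0" "1 - X i ^ d \<noteq> 0" "1 - X i ^ (d + 1) \<noteq> 0"
      using ne[of 1] ne[OF d_pos] ne[of "d + 1"] by simp_all
    show "fps_nth (?r j) 0 = 0" for j
    proof -
      have "axis i 0 = (0 :: nat ^ 'd)" by (simp add: axis_eq_0_iff)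
      then show ?thesis unfolding nth_mps_axis_fps coeff_rho by (simp only: c_0 mult_zero_left)
    qed
    show "fps_nth (?r j) k = X i ^ (k - 1) * (1 - X i ^ (k * d)) /
        ((1 - X i ^ d) * (1 - X i) ^ (k - 1) * (1 - X i ^ (d + 1)) ^ (k - 1)) * X i powi (j * int k)"
      if "k \<ge> 1" for j k
      unfolding nth_mps_axis_fps coeff_rho X_pow_axis \<alpha>_axis[OF that] mps_monom.rep_eq by simp
  qed
  then have "?r j = mps_axis_fps i (mps_const q * (1 - (\<Prod>l\<in>{-int d..int d}. 1 - rho X \<alpha> (j + l))))"
    by (simp only: mps_axis_fps_mult mps_axis_fps_diff mps_axis_fps_1 mps_axis_fps_const mps_axis_fps_prod)
  then have "fps_nth (?r j) k = fps_nth (mps_axis_fps i (mps_const q * (1 - (\<Prod>l\<in>{-int d..int d}. 1 - rho X \<alpha> (j + l))))) k"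
    by (rule arg_cong)
  then show ?thesis
    by (simp only: nth_mps_axis_fps)
qed

text \<open>The dependence on \<open>j\<close> separates as the factor \<open>X_pow X j n\<close>,
  because the vectors of a composition sum to \<open>n\<close>. Hence the recursion, which does not
  involve \<open>j\<close>, serves all \<open>j\<close> at once.\<close>

lemma coeff_rho_prod:
  assumes "B \<subseteq> {-int d..int d}" "card B = l"
  shows "mps_coeff (\<Prod>b\<in>B. rho X \<alpha> (j + b)) n =
    (\<Sum>gs\<in>vec_compositions l n. X_pow X j n *
      ((\<Prod>k<l. c (gs ! k)) * (\<Prod>k<l. X_pow X (sorted_list_of_set B ! k) (gs ! k))))"
proof -
  let ?b = "\<lambda>k. sorted_list_of_set B ! k"
  have "finite B" using assms(1) by (rule finite_subset) simp
  then have "mps_coeff (\<Prod>b\<in>B. rho X \<alpha> (j + b)) n =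
      (\<Sum>gs | length gs = l \<and> sum_list gs = n. \<Prod>k<l. c (gs ! k) * X_pow X (j + ?b k) (gs ! k))"
    by (simp only: prod_conv_sorted_nth assms(2) mps_coeff_prod coeff_rho)
  also have "\<dots> = (\<Sum>gs\<in>vec_compositions l n. \<Prod>k<l. c (gs ! k) * X_pow X (j + ?b k) (gs ! k))"
  proof (rule sum.mono_neutral_right)
    \<comment> \<open>Lists containing the zero vector contribute nothing because
      \<open>c 0 = 0\<close>.\<close>
    show "\<forall>gs\<in>{gs. length gs = l \<and> sum_list gs = n} - vec_compositions l n.
        (\<Prod>k<l. c (gs ! k) * X_pow X (j + ?b k) (gs ! k)) = 0"
    proof
      fix gs assume "gs \<in> {gs. length gs = l \<and> sum_list gs = n} - vec_compositions l n"
      then obtain k where "k < l" "gs ! k = 0"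
        by (auto simp: vec_compositions_def in_set_conv_nth)
      then show "(\<Prod>k<l. c (gs ! k) * X_pow X (j + ?b k) (gs ! k)) = 0"
        by (intro prod_zero) (auto intro!: bexI[of _ k])
    qed
  qed (auto simp: vec_compositions_def finite_vec_lists)
  also have "\<dots> = (\<Sum>gs\<in>vec_compositions l n. X_pow X j n *
      ((\<Prod>k<l. c (gs ! k)) * (\<Prod>k<l. X_pow X (?b k) (gs ! k))))"
  proof (rule sum.cong)
    fix gs assume "gs \<in> vec_compositions l n"
    then have "n = (\<Sum>k<l. gs ! k)"
      by (auto simp: vec_compositions_def sum_list_sum_nth atLeast0LessThan)
    then have "X_pow X j n = (\<Prod>k<l. X_pow X j (gs ! k))"
      by (simp only: X_pow_sum X_props(1) not_False_eq_True)
    then show "(\<Prod>k<l. c (gs ! k) * X_pow X (j + ?b k) (gs ! k)) =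
        X_pow X j n * ((\<Prod>k<l. c (gs ! k)) * (\<Prod>k<l. X_pow X (?b k) (gs ! k)))"
      by (simp add: X_pow_add_left X_props(1) prod.distrib mult_ac)
  qed simp
  finally show ?thesis .
qed

section \<open>Exponents with at least two nonzero coordinates\<close>

lemma vec_compositions_1:
  assumes "n \<noteq> 0"
  shows "vec_compositions 1 n = {[n]}"
  using assms by (auto simp: vec_compositions_def length_Suc_conv)

lemma E_1: "E 1 [n] = (\<Sum>b\<in>{-int d..int d}. X_pow X b n)"
proof -
  have "E 1 [n] = (\<Sum>B\<in>(\<lambda>b. {b}) ` {-int d..int d}. X_pow X (sorted_list_of_set B ! 0) n)"
    by (rule sum.cong) (auto simp: card_1_singleton_iff)
  also have "\<dots> = (\<Sum>b\<in>{-int d..int d}. X_pow X b n)"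
    by (subst sum.reindex) auto
  finally show ?thesis .
qed

text \<open>The right-hand side of the recursion consists of the terms with
  \<open>l \<ge> 2\<close>. The term for \<open>l = 1\<close> is \<open>c n\<close> times the sum of
  all \<open>X_pow X b n\<close>; subtracting the recursion from it leaves
  \<open>c n / q\<close>.\<close>

lemma rho_mixed_coeff:
  assumes "card {i. n $ i \<noteq> 0} \<ge> 2"
  shows "mps_coeff (rho X \<alpha> j) n = mps_coeff (mps_const q * (\<Sum>l=1..2 * d + 1. (- 1) ^ (l - 1) *
    (\<Sum>B | B \<subseteq> {-int d..int d} \<and> card B = l. \<Prod>b\<in>B. rho X \<alpha> (j + b)))) n"
proof -
  let ?F = "\<lambda>l. \<Sum>gs\<in>vec_compositions l n. (\<Prod>k<l. c (gs ! k)) * E l gs"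
  have n: "n \<noteq> 0" using assms by auto
  have F: "mps_coeff (\<Sum>B | B \<subseteq> {-int d..int d} \<and> card B = l. \<Prod>b\<in>B. rho X \<alpha> (j + b)) n =
      X_pow X j n * ?F l" for l
  proof -
    have "mps_coeff (\<Sum>B | B \<subseteq> {-int d..int d} \<and> card B = l. \<Prod>b\<in>B. rho X \<alpha> (j + b)) n =
        (\<Sum>B | B \<subseteq> {-int d..int d} \<and> card B = l. \<Sum>gs\<in>vec_compositions l n. X_pow X j n *
          ((\<Prod>k<l. c (gs ! k)) * (\<Prod>k<l. X_pow X (sorted_list_of_set B ! k) (gs ! k))))"
      unfolding mps_coeff_sum by (intro sum.cong) (auto simp: coeff_rho_prod)
    also have "\<dots> = X_pow X j n * ?F l"
      by (subst sum.swap) (simp only: sum_distrib_left)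
    finally show ?thesis .
  qed
  have "(\<Sum>l=1..2 * d + 1. (- 1) ^ (l - 1) * ?F l) = ?F 1 - (\<Sum>l=2..2 * d + 1. (- 1) ^ l * ?F l)"
  proof -
    \<comment> \<open>The signs of the recursion are opposite to those of the expansion.\<close>
    have "(\<Sum>l=2..2 * d + 1. (- 1) ^ (l - 1) * ?F l) = - (\<Sum>l=2..2 * d + 1. (- 1) ^ l * ?F l)"
      unfolding sum_negf[symmetric]
    proof (intro sum.cong refl)
      fix l assume "l \<in> {2..2 * d + 1}"
      then obtain m where "l = Suc m" by (cases l) auto
      then show "(- 1) ^ (l - 1) * ?F l = - ((- 1) ^ l * ?F l)" by simp
    qed
    moreover have "{1..2 * d + 1} = insert 1 {2..2 * d + 1}" by auto
    ultimately show ?thesis by simp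
  qed
  also have "?F 1 = c n * (\<Sum>b\<in>{-int d..int d}. X_pow X b n)"
    unfolding vec_compositions_1[OF n] using E_1[of n] by simp
  also have "(\<Sum>l=2..2 * d + 1. (- 1) ^ l * ?F l) =
      c n * (- (1 / q) + (\<Sum>l\<in>{-int d..int d}. X_pow X l n))"
    by (rule c_rec[OF assms, symmetric])
  also have "c n * (\<Sum>b\<in>{-int d..int d}. X_pow X b n) -
      c n * (- (1 / q) + (\<Sum>l\<in>{-int d..int d}. X_pow X l n)) = c n / q"
    by (simp add: algebra_simps)
  finally have sum: "(\<Sum>l=1..2 * d + 1. (- 1) ^ (l - 1) * ?F l) = c n / q" .
  have "mps_coeff (mps_const q * (\<Sum>l=1..2 * d + 1. (- 1) ^ (l - 1) *
      (\<Sum>B | B \<subseteq> {-int d..int d} \<and> card B = l. \<Prod>b\<in>B. rho X \<alpha> (j + b)))) n =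
      q * (\<Sum>l=1..2 * d + 1. (- 1) ^ (l - 1) * (X_pow X j n * ?F l))"
    by (simp only: mps_coeff_const_mult mps_coeff_sum[of _ "{1..2 * d + 1}"] mps_coeff_uminus_one_power F)
  also have "\<dots> = q * (X_pow X j n * (\<Sum>l=1..2 * d + 1. (- 1) ^ (l - 1) * ?F l))"
    by (simp only: sum_distrib_left[of "X_pow X j n" _ "{1..2 * d + 1}"] mult.left_commute)
  also have "\<dots> = c n * X_pow X j n"
    unfolding sum using q_nonzero by simp
  finally show ?thesis by (simp only: coeff_rho)
qed

lemma rho_equation:
  "rho X \<alpha> j = mps_const q * (1 - (\<Prod>l\<in>{-int d..int d}. 1 - rho X \<alpha> (j + l)))"
proof (rule mps_eqI)
  fix n :: "nat ^ 'd"
  \<comment> \<open>The zero exponent is written as \<open>axis i 0\<close> for an arbitrary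
    \<open>i\<close>, so that \<open>rho_axis_coeff\<close> handles it too.\<close>
  consider i where "n = axis i 0" | i k where "n = axis i k" "k \<ge> 1" | "card {i. n $ i \<noteq> 0} \<ge> 2"
    by (rule vec_support_cases[of n]) (auto simp: axis_eq_0_iff)
  then show "mps_coeff (rho X \<alpha> j) n =
      mps_coeff (mps_const q * (1 - (\<Prod>l\<in>{-int d..int d}. 1 - rho X \<alpha> (j + l)))) n"
  proof cases
    case 3
    have "card {-int d..int d} = 2 * d + 1" by simp
    then show ?thesis
      using rho_mixed_coeff[OF 3, of j] prod_one_minus[of "{-int d..int d}" "\<lambda>l. rho X \<alpha> (j + l)"]
      by (simp only: finite_atLeastAtMost_int simp_thms)
  qed (simp_all only: rho_axis_coeff)
qed

end

theorem proposition1: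
  fixes d :: nat
    and T :: "complex fps"
    and X :: "'d :: finite \<Rightarrow> puiseux"
    and \<alpha> :: "nat ^ 'd \<Rightarrow> (puiseux, 'd) mps"
  assumes "d = CARD('d)"
    and "fps_nth T 0 = 1"
    and "T = 1 + fps_X * T ^ (2 * d + 1)"
    and "bij_betw X UNIV (small_solutions d T)"
    and "alpha_family T X \<alpha>"
  shows "(\<forall>j. T_series T X \<alpha> j =
            1 + mps_const puiseux_z * (\<Prod>l\<in>{-int d..int d}. T_series T X \<alpha> (j + l)))
       \<and> (\<forall>j. rho X \<alpha> j =
            mps_const (puiseux_z * puiseux_of_fps T ^ (2 * d)) *
            (\<Sum>l=1..2 * d + 1. (- 1) ^ (l - 1) *
               (\<Sum>B | B \<subseteq> {-int d..int d} \<and> card B = l. \<Prod>b\<in>B. rho X \<alpha> (j + b))))"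
proof (intro conjI allI)
  interpret alpha_setup T X \<alpha> d
    using assms(1,2,4,5) by unfold_locales simp_all
  have card: "card {-int d..int d} = 2 * d + 1" by simp
  fix j
  show "rho X \<alpha> j = mps_const q * (\<Sum>l=1..2 * d + 1. (- 1) ^ (l - 1) *
      (\<Sum>B | B \<subseteq> {-int d..int d} \<and> card B = l. \<Prod>b\<in>B. rho X \<alpha> (j + b)))"
    using rho_equation[of j] prod_one_minus[of "{-int d..int d}" "\<lambda>l. rho X \<alpha> (j + l)"]
    by (simp only: finite_atLeastAtMost_int card simp_thms)
  define t z :: "(puiseux, 'd) mps" where "t = mps_const (puiseux_of_fps T)" and "z = mps_const puiseux_z"
  define P where "P = (\<Prod>l\<in>{-int d..int d}. 1 - rho X \<alpha> (j + l))"
  \<comment> \<open>The functional equation of \<open>T\<close> is carried over to Puiseux series,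
    and from there to constant series in several indeterminates.\<close>
  have "puiseux_of_fps T = 1 + puiseux_z * puiseux_of_fps T ^ (2 * d + 1)"
    by (subst assms(3)) (simp only: puiseux_of_fps_hom puiseux_z_def)
  then have t: "t = 1 + z * t ^ (2 * d + 1)"
    unfolding t_def z_def mps_const_hom[symmetric] by (rule arg_cong)
  have rho: "rho X \<alpha> j = z * t ^ (2 * d) * (1 - P)"
    unfolding z_def t_def P_def mps_const_hom(3,4)[symmetric] by (rule rho_equation)
  have "T_series T X \<alpha> j = t - z * t ^ (2 * d + 1) * (1 - P)"
    unfolding T_series_def t_def[symmetric] rho by (simp add: algebra_simps)
  also have "\<dots> = (t - z * t ^ (2 * d + 1)) + z * (t ^ (2 * d + 1) * P)"
    by (simp only: algebra_simps mult_1)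
  also have "t - z * t ^ (2 * d + 1) = 1"
    by (subst (1) t) simp
  \<comment> \<open>Each of the \<open>2 * d + 1\<close> factors absorbs one
    \<open>t\<close>.\<close>
  also have "t ^ (2 * d + 1) * P = (\<Prod>l\<in>{-int d..int d}. T_series T X \<alpha> (j + l))"
    unfolding T_series_def t_def[symmetric] P_def prod.distrib prod_constant card ..
  finally show "T_series T X \<alpha> j =
      1 + mps_const puiseux_z * (\<Prod>l\<in>{-int d..int d}. T_series T X \<alpha> (j + l))"
    unfolding z_def .
qed

end
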